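(* Let $n\geq 1$ and let $G$ be a finite group. Then $$|E(G\wr\mathcal T_n)|=\sum_{k=1}^n\binom nk k^{n-k}|G|^{n-k}.$$
   Context: $\mathcal T_n$ is the full transformation monoid on $\{1,\ldots,n\}$: all maps $\{1,\ldots,n\}\to\{1,\ldots,n\}$, written on the right of their arguments and composed from left to right. The wreath product $G\wr\mathcal T_n$ is the set $G^n\times\mathcal T_n$ with product $$((a_1,\ldots,a_n),\alpha)((b_1,\ldots,b_n),\beta)=((a_1b_{1\alpha},\ldots,a_nb_{n\alpha}),\alpha\beta).$$ For a semigroup $T$, $E(T)=\{x\in T:x^2=x\}$. *)

theory Defs
  imports "HOL-Algebra.Coset" "HOL-Library.FuncSet"
begin

text \<open>
  Maps act on the right and are composed from left to right: the product \<open>\<alpha> \<beta>\<close>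
  applies \<open>\<alpha>\<close> first, whereas \<^const>\<open>compose\<close> takes the map applied first as its
  last argument.  Maps and \<open>n\<close>-tuples are functions extensional on \<open>{1..n}\<close>, so that
  equality of functions is equality of maps and tuples.
\<close>

definition full_transformation_monoid :: "nat \<Rightarrow> (nat \<Rightarrow> nat) monoid"
  where "full_transformation_monoid n =
    \<lparr> carrier = {1..n} \<rightarrow>\<^sub>E {1..n},
      mult = (\<lambda>\<alpha> \<beta>. compose {1..n} \<beta> \<alpha>),
      one = (\<lambda>i\<in>{1..n}. i) \<rparr>"

definition wreath_product ::
    "('a, 'b) monoid_scheme \<Rightarrow> nat \<Rightarrow> ((nat \<Rightarrow> 'a) \<times> (nat \<Rightarrow> nat)) monoid"
  where "wreath_product G n =
    \<lparr> carrier = ({1..n} \<rightarrow>\<^sub>E carrier G) \<times> carrier (full_transformation_monoid n),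
      mult = (\<lambda>(a, \<alpha>) (b, \<beta>).
        (\<lambda>i\<in>{1..n}. a i \<otimes>\<^bsub>G\<^esub> b (\<alpha> i), \<alpha> \<otimes>\<^bsub>full_transformation_monoid n\<^esub> \<beta>)),
      one = (\<lambda>i\<in>{1..n}. \<one>\<^bsub>G\<^esub>, \<one>\<^bsub>full_transformation_monoid n\<^esub>) \<rparr>"

definition idempotents :: "('a, 'b) monoid_scheme \<Rightarrow> 'a set"
  where "idempotents T = {x \<in> carrier T. x \<otimes>\<^bsub>T\<^esub> x = x}"

end

theory Submission
  imports Defs
begin

text \<open>
  A pair \<open>(a, \<alpha>)\<close> is idempotent iff \<open>\<alpha>\<close> fixes its image \<open>A\<close> pointwise and \<open>a\<close> is trivial
  on \<open>A\<close>, because \<open>a\<^sub>i a\<^bsub>i\<alpha>\<^esub> = a\<^sub>i\<close> means \<open>a\<^bsub>i\<alpha>\<^esub> = 1\<close>.  Once \<open>A\<close> of size \<open>k\<close> is chosen, each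
  of the \<open>n - k\<close> remaining points has a free image in \<open>A\<close> and a free entry in \<open>G\<close>.
\<close>

text \<open>For fixed \<open>A\<close> the constraints on \<open>a\<close> and
  \<open>\<alpha>\<close> are independent from point to point, so the set is a product of two
  dependent function spaces and can be counted factor by factor. That \<open>\<alpha>\<close> maps
  onto \<open>A\<close>, for \<open>A\<close> inside \<open>{1..n}\<close>, is implicit: every point
  of \<open>A\<close> is its own preimage.\<close>

definition idempotents_with_image ::
    "('a, 'b) monoid_scheme \<Rightarrow> nat \<Rightarrow> nat set \<Rightarrow> ((nat \<Rightarrow> 'a) \<times> (nat \<Rightarrow> nat)) set"
  where "idempotents_with_image G n A =
    (\<Pi>\<^sub>E i\<in>{1..n}. if i \<in> A then {\<one>\<^bsub>G\<^esub>} else carrier G) \<times> (\<Pi>\<^sub>E i\<in>{1..n}. if i \<in> A then {i} else A)"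

text \<open>Each point of \<open>A\<close> contributes a factor 1, each other point a factor
  \<open>card B\<close>. The forced value \<open>f i\<close> is left general to cover both the
  constant identity of the group and the identity map.\<close>

lemma card_PiE_if:
  assumes "finite S" "A \<subseteq> S"
  shows "card (\<Pi>\<^sub>E i\<in>S. if i \<in> A then {f i} else B) = card B ^ (card S - card A)"
proof -
  have "(\<Prod>i\<in>S. card (if i \<in> A then {f i} else B)) = (\<Prod>i\<in>S. if i \<in> A then 1 else card B)"
    by (rule prod.cong) auto
  also have "\<dots> = card B ^ card (S - A)"
    using assms by (simp add: prod.If_cases Diff_eq)
  finally show ?thesis
    using assms by (simp add: card_PiE card_Diff_subset finite_subset)
qed

lemma card_idempotents_with_image:
  assumes "A \<subseteq> {1..n}"
  shows "card (idempotents_with_image G n A) = card A ^ (n - card A) * order G ^ (n - card A)"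
  using assms unfolding idempotents_with_image_def
  by (simp add: card_cartesian_product card_PiE_if order_def)

lemma finite_idempotents_with_image:
  assumes "finite (carrier G)" "A \<subseteq> {1..n}"
  shows "finite (idempotents_with_image G n A)"
  using assms unfolding idempotents_with_image_def
  by (intro finite_cartesian_product finite_PiE) (simp_all add: finite_subset)

text \<open>Recovers \<open>A\<close> from the pair, which makes the sets for different
  \<open>A\<close> disjoint.\<close>

lemma image_of_idempotents_with_image:
  assumes "(a, \<alpha>) \<in> idempotents_with_image G n A" "A \<subseteq> {1..n}"
  shows "\<alpha> ` {1..n} = A"
proof -
  have \<alpha>: "\<alpha> i \<in> (if i \<in> A then {i} else A)" if "i \<in> {1..n}" for i
    using assms(1) that unfolding idempotents_with_image_def by (blast dest: PiE_mem)
  show ?thesis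
  proof
    show "\<alpha> ` {1..n} \<subseteq> A"
    proof (rule image_subsetI)
      show "\<alpha> i \<in> A" if "i \<in> {1..n}" for i
        using \<alpha>[OF that] by (cases "i \<in> A") simp_all
    qed
    show "A \<subseteq> \<alpha> ` {1..n}"
    proof
      fix i assume "i \<in> A"
      then have "i \<in> {1..n}" "\<alpha> i = i"
        using assms(2) \<alpha>[of i] by auto
      then show "i \<in> \<alpha> ` {1..n}" by (metis imageI)
    qed
  qed
qed

lemma restrict_eq_iff:
  assumes "f \<in> extensional S"
  shows "restrict h S = f \<longleftrightarrow> (\<forall>i\<in>S. h i = f i)"
  using assms by (metis extensionalityI restrict_apply' restrict_extensional)

lemma idempotent_wreath_product_iff:
  assumes "group G"
  shows "(a, \<alpha>) \<in> idempotents (wreath_product G n) \<longleftrightarrow>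
    a \<in> {1..n} \<rightarrow>\<^sub>E carrier G \<and> \<alpha> \<in> {1..n} \<rightarrow>\<^sub>E {1..n} \<and>
    (\<forall>i\<in>{1..n}. a (\<alpha> i) = \<one>\<^bsub>G\<^esub> \<and> \<alpha> (\<alpha> i) = \<alpha> i)"
proof (cases "a \<in> {1..n} \<rightarrow>\<^sub>E carrier G \<and> \<alpha> \<in> {1..n} \<rightarrow>\<^sub>E {1..n}")
  case True
  interpret group G by fact
  have a: "(\<lambda>i\<in>{1..n}. a i \<otimes>\<^bsub>G\<^esub> a (\<alpha> i)) = a \<longleftrightarrow> (\<forall>i\<in>{1..n}. a i \<otimes>\<^bsub>G\<^esub> a (\<alpha> i) = a i)"
    using True by (intro restrict_eq_iff) (simp add: PiE_def)
  have \<alpha>: "compose {1..n} \<alpha> \<alpha> = \<alpha> \<longleftrightarrow> (\<forall>i\<in>{1..n}. \<alpha> (\<alpha> i) = \<alpha> i)"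
    using True unfolding compose_def by (intro restrict_eq_iff) (simp add: PiE_def)
  have "a i \<otimes>\<^bsub>G\<^esub> a (\<alpha> i) = a i \<longleftrightarrow> a (\<alpha> i) = \<one>\<^bsub>G\<^esub>" if "i \<in> {1..n}" for i
  proof -
    have "\<alpha> i \<in> {1..n}" "a i \<in> carrier G"
      using True that by (auto dest: PiE_mem)
    moreover from this have "a (\<alpha> i) \<in> carrier G"
      using True by (auto dest: PiE_mem)
    ultimately show ?thesis by simp
  qed
  then show ?thesis
    using True unfolding idempotents_def wreath_product_def full_transformation_monoid_def
    \<comment> \<open>Deleting \<open>One_nat_def\<close> keeps \<open>{1..n}\<close> from becoming
      \<open>{Suc 0..n}\<close>, so that the equivalences \<open>a\<close> and
      \<open>\<alpha>\<close> still match.\<close>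
    by (simp add: a \<alpha> ball_conj_distrib del: One_nat_def)
\<comment> \<open>Outside the carrier both sides are false.\<close>
qed (auto simp: idempotents_def wreath_product_def full_transformation_monoid_def)

lemma idempotents_wreath_product_eq_UN:
  assumes "group G"
  shows "idempotents (wreath_product G n) = (\<Union>A\<in>Pow {1..n}. idempotents_with_image G n A)"
proof (intro subset_antisym subsetI)
  fix x assume "x \<in> idempotents (wreath_product G n)"
  moreover obtain a \<alpha> where x: "x = (a, \<alpha>)" by (cases x)
  ultimately have *: "a \<in> {1..n} \<rightarrow>\<^sub>E carrier G" "\<alpha> \<in> {1..n} \<rightarrow>\<^sub>E {1..n}"
    "\<forall>i\<in>{1..n}. a (\<alpha> i) = \<one>\<^bsub>G\<^esub> \<and> \<alpha> (\<alpha> i) = \<alpha> i"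
    using idempotent_wreath_product_iff[OF assms] by blast+
  \<comment> \<open>The witness for \<open>A\<close> is the image of \<open>\<alpha>\<close>. A
    point of it has the form \<open>\<alpha> j\<close>, and the equations at \<open>j\<close> say
    that \<open>a\<close> is trivial there and that \<open>\<alpha>\<close> fixes it.\<close>
  have "a \<in> (\<Pi>\<^sub>E i\<in>{1..n}. if i \<in> \<alpha> ` {1..n} then {\<one>\<^bsub>G\<^esub>} else carrier G)"
    using * by (intro PiE_I) (auto dest: PiE_mem PiE_arb)
  moreover have "\<alpha> \<in> (\<Pi>\<^sub>E i\<in>{1..n}. if i \<in> \<alpha> ` {1..n} then {i} else \<alpha> ` {1..n})"
    using * by (intro PiE_I) (auto dest: PiE_arb)
  moreover have "\<alpha> ` {1..n} \<in> Pow {1..n}"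
    using *(2) by (auto dest: PiE_mem)
  ultimately show "x \<in> (\<Union>A\<in>Pow {1..n}. idempotents_with_image G n A)"
    unfolding x idempotents_with_image_def by blast
next
  fix x assume "x \<in> (\<Union>A\<in>Pow {1..n}. idempotents_with_image G n A)"
  then obtain A a \<alpha> where x: "x = (a, \<alpha>)" and A: "A \<subseteq> {1..n}"
    and mem: "(a, \<alpha>) \<in> idempotents_with_image G n A"
    by (cases x) auto
  interpret group G by fact
  have a: "a \<in> (\<Pi>\<^sub>E i\<in>{1..n}. if i \<in> A then {\<one>\<^bsub>G\<^esub>} else carrier G)"
    and \<alpha>: "\<alpha> \<in> (\<Pi>\<^sub>E i\<in>{1..n}. if i \<in> A then {i} else A)"
    using mem by (auto simp: idempotents_with_image_def)
  have image: "\<alpha> i \<in> A" if "i \<in> {1..n}" for i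
    using image_of_idempotents_with_image[OF mem A] that by blast
  have fixed: "a i = \<one>\<^bsub>G\<^esub>" "\<alpha> i = i" if "i \<in> A" for i
    using PiE_mem[OF a, of i] PiE_mem[OF \<alpha>, of i] that A by auto
  have "a \<in> {1..n} \<rightarrow>\<^sub>E carrier G"
  proof (rule PiE_I)
    show "a i \<in> carrier G" if "i \<in> {1..n}" for i
      using PiE_mem[OF a that] by (auto split: if_splits)
  qed (rule PiE_arb[OF a])
  moreover have "\<alpha> \<in> {1..n} \<rightarrow>\<^sub>E {1..n}"
    using image A by (intro PiE_I PiE_arb[OF \<alpha>]) blast+
  \<comment> \<open>Both equations at \<open>i\<close> follow from \<open>fixed\<close> at the point
    \<open>\<alpha> i\<close>, which lies in \<open>A\<close> by \<open>image\<close>.\<close>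
  ultimately show "x \<in> idempotents (wreath_product G n)"
    using image fixed by (simp add: x idempotent_wreath_product_iff[OF assms])
qed

text \<open>The subsets are grouped by size; the summand is constant on each group.\<close>

lemma sum_Pow_card:
  fixes f :: "nat \<Rightarrow> 'c::comm_semiring_1"
  assumes "finite S"
  shows "(\<Sum>A\<in>Pow S. f (card A)) = (\<Sum>k = 0..card S. of_nat (card S choose k) * f k)"
proof -
  have "(\<Sum>A\<in>Pow S. f (card A)) = (\<Sum>k = 0..card S. \<Sum>A\<in>{A \<in> Pow S. card A = k}. f (card A))"
    using assms by (intro sum.group[symmetric]) (auto simp: card_mono)
  also have "\<dots> = (\<Sum>k = 0..card S. of_nat (card S choose k) * f k)"
    using n_subsets[OF assms] by (intro sum.cong) auto
  finally show ?thesis .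
qed

theorem corollary4p5:
  fixes G :: "('a, 'b) monoid_scheme" and n :: nat
  assumes "n \<ge> 1" and "group G" and "finite (carrier G)"
  shows "card (idempotents (wreath_product G n)) =
    (\<Sum>k = 1..n. (n choose k) * k ^ (n - k) * order G ^ (n - k))"
proof -
  have disjoint: "idempotents_with_image G n A \<inter> idempotents_with_image G n B = {}"
    if "A \<subseteq> {1..n}" "B \<subseteq> {1..n}" "A \<noteq> B" for A B
  proof (rule equals0I)
    fix x assume "x \<in> idempotents_with_image G n A \<inter> idempotents_with_image G n B"
    then have "snd x ` {1..n} = A" "snd x ` {1..n} = B"
      using image_of_idempotents_with_image[of "fst x" "snd x" G n] that by auto
    with \<open>A \<noteq> B\<close> show False by simp
  qed
  have "card (idempotents (wreath_product G n)) =
      (\<Sum>A\<in>Pow {1..n}. card (idempotents_with_image G n A))"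
    unfolding idempotents_wreath_product_eq_UN[OF assms(2)]
    by (intro card_UN_disjoint) (simp_all add: finite_idempotents_with_image[OF assms(3)] disjoint)
  also have "\<dots> = (\<Sum>A\<in>Pow {1..n}. card A ^ (n - card A) * order G ^ (n - card A))"
    by (intro sum.cong) (auto simp: card_idempotents_with_image)
  also have "\<dots> = (\<Sum>k = 0..n. (n choose k) * (k ^ (n - k) * order G ^ (n - k)))"
    using sum_Pow_card[of "{1..n}" "\<lambda>k. k ^ (n - k) * order G ^ (n - k)"] by simp
  \<comment> \<open>The term for \<open>k = 0\<close>, coming from the empty \<open>A\<close>,
    contains the factor \<open>0 ^ n\<close>, which vanishes because \<open>n\<close> is
    positive.\<close>
  also have "\<dots> = (\<Sum>k = 1..n. (n choose k) * (k ^ (n - k) * order G ^ (n - k)))"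
    using assms(1) by (simp add: sum.atLeast_Suc_atMost)
  finally show ?thesis by (simp add: mult.assoc)
qed

end
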